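(* Let $C$ be a nonempty closed convex subset of a real Hilbert space $H$ and $T$ a nonexpansive mapping of $C$ into itself with $F(T)\ne\emptyset$. Let $\{\alpha_n\}_{n\ge0}$ be a real sequence with $0<\alpha\le\alpha_n\le1$ for all $n$ (for some constant $\alpha$). Let $x_0\in C$ be arbitrary and let $\{x_n\}$ be given, for $n\ge0$, by $$y_n=(1-\alpha_n)x_n+\alpha_nTx_n,$$ $$C_n=\{z\in C:\|y_n-z\|\le\|x_n-z\|\},$$ $$Q_n=\{z\in C:\langle z-x_n,x_n-x_0\rangle\ge0\},$$ $$x_{n+1}=P_{C_n^*\cap Q_n}x_0,$$ where $C_n^*$ is a closed convex set with $F(T)\subset C_n^*\subset C_n$. Then $\{x_n\}$ converges strongly to $P_{F(T)}x_0$.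
   Context: $F(T)=\{x\in C:Tx=x\}$. $T$ is nonexpansive if $\|Tx-Ty\|\le\|x-y\|$ for all $x,y\in C$. For a nonempty closed convex set $D\subset H$, $P_D$ is the metric projection (nearest-point map) onto $D$. *)

theory Defs
  imports "HOL-Analysis.Analysis"
begin

definition nonexpansive_on :: "'a::real_normed_vector set \<Rightarrow> ('a \<Rightarrow> 'a) \<Rightarrow> bool"
  where "nonexpansive_on C T \<longleftrightarrow> (\<forall>x\<in>C. \<forall>y\<in>C. norm (T x - T y) \<le> norm (x - y))"

definition fixed_points :: "'a set \<Rightarrow> ('a \<Rightarrow> 'a) \<Rightarrow> 'a set"
  where "fixed_points C T = {x \<in> C. T x = x}"

text \<open>
  The library's \<^const>\<open>closest_point\<close> has the same definition, but its type requires
  the Heine--Borel property, which excludes infinite-dimensional Hilbert spaces. The value is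
  unspecified if no nearest point exists, so a statement about \<open>metric_proj D\<close> carries content
  only where \<open>D\<close> has one, for example when \<open>D\<close> is nonempty, closed and convex.
\<close>

definition metric_proj :: "'a::{real_inner,complete_space} set \<Rightarrow> 'a \<Rightarrow> 'a"
  where "metric_proj D a = (SOME p. p \<in> D \<and> (\<forall>z\<in>D. norm (a - p) \<le> norm (a - z)))"

end

theory Submission
  imports Defs
begin

text \<open>
  Write \<open>p\<close> for a point of \<open>F(T)\<close> nearest to \<open>x\<^sub>0\<close>. By definition of the half-space in \<open>Q\<^sub>n\<close>, \<open>x\<^sub>n\<close> is the point of
  \<open>Q\<^sub>n\<close> nearest to \<open>x\<^sub>0\<close>, and the variational inequality for the projection \<open>x\<^sub>n\<^sub>+\<^sub>1\<close> says exactly that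
  \<open>C\<^sub>n\<^sup>* \<inter> Q\<^sub>n \<subseteq> Q\<^sub>n\<^sub>+\<^sub>1\<close>; so \<open>F(T)\<close> stays inside every \<open>Q\<^sub>n\<close>. Since the angle at \<open>x\<^sub>n\<close> between \<open>x\<^sub>0\<close> and
  a point \<open>z\<close> of \<open>Q\<^sub>n\<close> is at least a right angle, \<open>\<parallel>z - x\<^sub>n\<parallel>\<^sup>2 \<le> \<parallel>z - x\<^sub>0\<parallel>\<^sup>2 - \<parallel>x\<^sub>n - x\<^sub>0\<parallel>\<^sup>2\<close>. Taking \<open>z = x\<^sub>n\<^sub>+\<^sub>1\<close> shows
  that the distances \<open>\<parallel>x\<^sub>n - x\<^sub>0\<parallel>\<close> increase to some limit \<open>d\<close> and that \<open>x\<^sub>n\<^sub>+\<^sub>1 - x\<^sub>n \<rightarrow> 0\<close>; as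
  \<open>x\<^sub>n\<^sub>+\<^sub>1 \<in> C\<^sub>n\<close> and \<open>\<alpha>\<^sub>n\<close> is bounded away from zero, \<open>x\<^sub>n - T x\<^sub>n \<rightarrow> 0\<close>. Taking \<open>z = p\<close> reduces the
  theorem to the single inequality \<open>\<parallel>p - x\<^sub>0\<parallel> \<le> d\<close>.

  The usual way to that inequality extracts a weakly convergent subsequence and applies the
  demiclosedness principle. The proof below avoids weak topologies. It compares \<open>x\<^sub>n\<close> with
  Browder's approximants, the solutions \<open>z\<^sub>k\<close> of \<open>z - T z = (x\<^sub>0 - z) / (k + 1)\<close>, which converge strongly to a
  nearest fixed point (\<open>browder_approximants\<close>). Because \<open>I - T\<close> is monotone, a bounded
  sequence \<open>w\<^sub>n\<close> with \<open>w\<^sub>n - T w\<^sub>n \<rightarrow> 0\<close> satisfies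
  \<open>liminf \<langle>x\<^sub>0 - z\<^sub>k, z\<^sub>k - w\<^sub>n\<rangle> \<ge> 0\<close> for each \<open>k\<close>, so \<open>w\<^sub>n\<close> is asymptotically at least as
  far from \<open>x\<^sub>0\<close> as \<open>z\<^sub>k\<close>; then \<open>k \<rightarrow> \<infinity>\<close>
  (\<open>nearest_fixed_point_dist_le\<close>).
\<close>

section \<open>Metric projections in Hilbert space\<close>

lemma obtuse_angle_norm_le:
  fixes x z a :: "'a::real_inner"
  assumes "inner (z - x) (x - a) \<ge> 0"
  shows "(norm (z - x))\<^sup>2 \<le> (norm (z - a))\<^sup>2 - (norm (x - a))\<^sup>2"
proof -
  have "(norm (z - a))\<^sup>2 = (norm (z - x))\<^sup>2 + 2 * inner (z - x) (x - a) + (norm (x - a))\<^sup>2"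
    unfolding power2_norm_eq_inner by (simp add: inner_diff_left inner_diff_right inner_commute algebra_simps)
  then show ?thesis using assms by linarith
qed

lemma tendsto_0_if_norm_square_le:
  fixes f :: "nat \<Rightarrow> 'a::real_normed_vector"
  assumes "e \<longlonglongrightarrow> 0" and "\<And>n. (norm (f n))\<^sup>2 \<le> e n"
  shows "f \<longlonglongrightarrow> 0"
proof -
  have "(\<lambda>n. (norm (f n))\<^sup>2) \<longlonglongrightarrow> 0"
    by (rule Lim_null_comparison[OF _ assms(1)]) (simp add: assms(2))
  from tendsto_real_sqrt[OF this] show ?thesis by (simp add: tendsto_norm_zero_iff)
qed

text \<open>
  Minimizing sequences and Browder's approximants both converge through a bound of this shape
  on the mutual distances.
\<close>

lemma convergent_if_dist_le_null:
  fixes u :: "nat \<Rightarrow> 'a::{real_normed_vector,complete_space}" and e :: "nat \<Rightarrow> real"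
  assumes "e \<longlonglongrightarrow> 0" and le: "\<And>m n. m \<le> n \<Longrightarrow> (norm (u m - u n))\<^sup>2 \<le> e m + e n"
  shows "convergent u"
proof -
  have "Cauchy u"
  proof (rule CauchyI')
    fix r :: real assume "r > 0"
    then have "r\<^sup>2 / 2 > 0" by simp
    with assms(1) obtain M where M: "\<And>n. n \<ge> M \<Longrightarrow> norm (e n - 0) < r\<^sup>2 / 2"
      by (meson LIMSEQ_D)
    have "norm (u m - u n) < r" if "M \<le> m" "m < n" for m n
    proof -
      have "(norm (u m - u n))\<^sup>2 < r\<^sup>2"
        using le[of m n] M[of m] M[of n] that by simp
      with \<open>r > 0\<close> show ?thesis by (simp add: power2_less_imp_less)
    qed
    then show "\<exists>M. \<forall>m\<ge>M. \<forall>n>m. dist (u m) (u n) < r" by (auto simp: dist_norm)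
  qed
  then show ?thesis by (rule Cauchy_convergent)
qed

lemma metric_proj_nearest:
  assumes "\<exists>p\<in>D. \<forall>z\<in>D. norm (a - p) \<le> norm (a - z)"
  shows "metric_proj D a \<in> D" and "\<And>z. z \<in> D \<Longrightarrow> norm (a - metric_proj D a) \<le> norm (a - z)"
proof -
  have "metric_proj D a \<in> D \<and> (\<forall>z\<in>D. norm (a - metric_proj D a) \<le> norm (a - z))"
    unfolding metric_proj_def by (rule someI_ex) (use assms in blast)
  then show "metric_proj D a \<in> D"
    and "\<And>z. z \<in> D \<Longrightarrow> norm (a - metric_proj D a) \<le> norm (a - z)" by auto
qed

text \<open>
  The parallelogram law makes every minimizing sequence Cauchy: by convexity, the midpoint of
  two almost nearest points is no nearer than the infimum, which forces them close together.
\<close>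

lemma nearest_point_exists:
  fixes D :: "'a::{real_inner,complete_space} set"
  assumes "closed D" and "convex D" and "D \<noteq> {}"
  shows "\<exists>p\<in>D. \<forall>z\<in>D. norm (a - p) \<le> norm (a - z)"
proof -
  define \<delta> where "\<delta> = (INF z\<in>D. (norm (a - z))\<^sup>2)"
  have bdd: "bdd_below ((\<lambda>z. (norm (a - z))\<^sup>2) ` D)"
    by (rule bdd_belowI[of _ 0]) auto
  have lower: "\<delta> \<le> (norm (a - z))\<^sup>2" if "z \<in> D" for z
    unfolding \<delta>_def by (rule cINF_lower[OF bdd that])
  have "\<exists>z\<in>D. (norm (a - z))\<^sup>2 < \<delta> + inverse (real (Suc n))" for n
    using cINF_less_iff[OF assms(3) bdd, of "\<delta> + inverse (real (Suc n))"]
    by (simp add: \<delta>_def[symmetric])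
  then obtain w where w: "\<And>n. w n \<in> D"
    and wn: "\<And>n. (norm (a - w n))\<^sup>2 < \<delta> + inverse (real (Suc n))"
    by metis
  have "convergent w"
  proof (rule convergent_if_dist_le_null[where e = "\<lambda>n. 2 * inverse (real (Suc n))"])
    show "(\<lambda>n. 2 * inverse (real (Suc n))) \<longlonglongrightarrow> 0"
      using tendsto_mult_right_zero[OF LIMSEQ_inverse_real_of_nat] by simp
  next
    fix m n :: nat
    let ?mid = "(1/2) *\<^sub>R w m + (1/2) *\<^sub>R w n"
    have "?mid \<in> D" by (rule convexD[OF assms(2)]) (auto simp: w)
    then have "\<delta> \<le> (norm (a - ?mid))\<^sup>2" by (rule lower)
    moreover have "(norm (w m - w n))\<^sup>2
        = 2 * (norm (a - w m))\<^sup>2 + 2 * (norm (a - w n))\<^sup>2 - 4 * (norm (a - ?mid))\<^sup>2"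
      unfolding power2_norm_eq_inner
      by (simp add: inner_diff_left inner_diff_right inner_add_left inner_add_right
          inner_commute algebra_simps)
    ultimately show "(norm (w m - w n))\<^sup>2
        \<le> 2 * inverse (real (Suc m)) + 2 * inverse (real (Suc n))"
      using wn[of m] wn[of n] by linarith
  qed
  then obtain p where p: "w \<longlonglongrightarrow> p" by (auto simp: convergent_def)
  have "p \<in> D" using closed_sequentially[OF assms(1) _ p] w by blast
  moreover have "norm (a - p) \<le> norm (a - z)" if "z \<in> D" for z
  proof (rule power2_le_imp_le)
    have "(norm (a - p))\<^sup>2 \<le> \<delta> + 0"
    proof (rule LIMSEQ_le)
      show "(\<lambda>n. (norm (a - w n))\<^sup>2) \<longlonglongrightarrow> (norm (a - p))\<^sup>2"
        by (intro tendsto_intros p)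
      show "(\<lambda>n. \<delta> + inverse (real (Suc n))) \<longlonglongrightarrow> \<delta> + 0"
        by (intro tendsto_add tendsto_const LIMSEQ_inverse_real_of_nat)
    qed (use wn less_imp_le in blast)
    then show "(norm (a - p))\<^sup>2 \<le> (norm (a - z))\<^sup>2" using lower[OF that] by linarith
  qed simp
  ultimately show ?thesis by blast
qed

lemma metric_proj_variational:
  assumes "closed D" and "convex D" and "z \<in> D"
  shows "inner (z - metric_proj D a) (metric_proj D a - a) \<ge> 0"
proof -
  let ?p = "metric_proj D a"
  have ex: "\<exists>p\<in>D. \<forall>z\<in>D. norm (a - p) \<le> norm (a - z)"
    using nearest_point_exists assms by blast
  have "inner (a - ?p) (z - ?p) \<le> 0"
    using any_closest_point_dot[OF assms(2,1) metric_proj_nearest(1)[OF ex] assms(3), of a]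
      metric_proj_nearest(2)[OF ex]
    by (simp add: dist_norm)
  then show ?thesis
    by (simp add: inner_diff_left inner_diff_right inner_commute)
qed

section \<open>Nearest fixed points of nonexpansive maps\<close>

lemma nonexpansive_monotone:
  fixes T :: "'a::real_inner \<Rightarrow> 'a"
  assumes "nonexpansive_on C T" and "u \<in> C" and "v \<in> C"
  shows "inner ((u - T u) - (v - T v)) (u - v) \<ge> 0"
proof -
  have "inner (T u - T v) (u - v) \<le> norm (T u - T v) * norm (u - v)"
    by (rule norm_cauchy_schwarz)
  also have "\<dots> \<le> norm (u - v) * norm (u - v)"
    using assms by (auto simp: nonexpansive_on_def intro: mult_right_mono)
  also have "\<dots> = inner (u - v) (u - v)"
    by (simp add: norm_eq_sqrt_inner)
  finally show ?thesis by (simp add: inner_diff_left)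
qed

text \<open>
  Monotonicity of \<open>I - T\<close>, applied to two approximants, orders their distances to \<open>a\<close> and
  makes the squared gap at most the difference of the squared distances; applied
  to an approximant and a fixed point, it bounds these distances by the distance to the
  fixed point. Hence the distances converge and the approximants are Cauchy; their limit is
  fixed because the right-hand side of the defining equation vanishes, and nearest by the
  second bound.
\<close>

lemma browder_approximants:
  fixes C :: "'a::{real_inner,complete_space} set"
  assumes "closed C" and "convex C" and "T \<in> C \<rightarrow> C" and ne: "nonexpansive_on C T"
    and "fixed_points C T \<noteq> {}" and "a \<in> C"
  obtains z p where "\<And>n::nat. z n \<in> C"
    and "\<And>n. z n - T (z n) = (1 / (real n + 1)) *\<^sub>R (a - z n)"
    and "z \<longlonglongrightarrow> p" and "p \<in> fixed_points C T"
    and "\<And>q. q \<in> fixed_points C T \<Longrightarrow> norm (a - p) \<le> norm (a - q)"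
proof -
  have "\<exists>z\<in>C. z - T z = (1 / (real n + 1)) *\<^sub>R (a - z)" for n :: nat
  proof -
    \<comment> \<open>The equation reads \<open>z = t a + (1 - t) T z\<close> with \<open>t = 1 / (n + 2)\<close>, and the
      right-hand side is a contraction.\<close>
    define t where "t = 1 / (real n + 2)"
    have t: "0 < t" "t < 1" by (auto simp: t_def)
    have "\<exists>!z. z \<in> C \<and> t *\<^sub>R a + (1 - t) *\<^sub>R T z = z"
    proof (rule Banach_fix[where c = "1 - t"])
      show "complete C" using assms(1) by (simp add: complete_eq_closed)
      show "C \<noteq> {}" using assms(6) by blast
      show "(\<lambda>z. t *\<^sub>R a + (1 - t) *\<^sub>R T z) ` C \<subseteq> C"
        using t assms(3,6) by (auto intro!: convexD[OF assms(2)])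
      show "dist (t *\<^sub>R a + (1 - t) *\<^sub>R T u) (t *\<^sub>R a + (1 - t) *\<^sub>R T v) \<le> (1 - t) * dist u v"
        if "u \<in> C" "v \<in> C" for u v
      proof -
        have "norm (T u - T v) \<le> norm (u - v)" using ne that by (auto simp: nonexpansive_on_def)
        moreover have "dist (t *\<^sub>R a + (1 - t) *\<^sub>R T u) (t *\<^sub>R a + (1 - t) *\<^sub>R T v)
            = (1 - t) * norm (T u - T v)"
          using t by (simp add: dist_norm scaleR_diff_right[symmetric])
        ultimately show ?thesis using t by (simp add: dist_norm mult_left_mono)
      qed
    qed (use t in auto)
    then obtain z where "z \<in> C" and z: "t *\<^sub>R a + (1 - t) *\<^sub>R T z = z" by blast
    have "(real n + 2) *\<^sub>R z = (real n + 2) *\<^sub>R (t *\<^sub>R a + (1 - t) *\<^sub>R T z)" using z by simp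
    also have "\<dots> = ((real n + 2) * t) *\<^sub>R a + ((real n + 2) * (1 - t)) *\<^sub>R T z"
      by (simp add: scaleR_add_right)
    also have "\<dots> = a + (real n + 1) *\<^sub>R T z"
    proof -
      have "(real n + 2) * t = 1" by (simp add: t_def add_nonneg_pos less_imp_neq[THEN not_sym])
      then have "(real n + 2) * (1 - t) = real n + 1" by (simp add: right_diff_distrib)
      with \<open>(real n + 2) * t = 1\<close> show ?thesis by simp
    qed
    finally have "(real n + 1) *\<^sub>R (z - T z) = a - z"
      by (simp add: algebra_simps scaleR_2)
    moreover have "z - T z = (1 / (real n + 1)) *\<^sub>R ((real n + 1) *\<^sub>R (z - T z))"
      by (simp add: add_nonneg_pos less_imp_neq[THEN not_sym])
    ultimately have "z - T z = (1 / (real n + 1)) *\<^sub>R (a - z)" by simp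
    with \<open>z \<in> C\<close> show ?thesis by blast
  qed
  then obtain z where zC: "\<And>n. z n \<in> C"
    and z: "\<And>n. z n - T (z n) = (1 / (real n + 1)) *\<^sub>R (a - z n)"
    by metis
  define r where "r n = (norm (z n - a))\<^sup>2" for n
  have gap: "(norm (z n - z m))\<^sup>2 \<le> r n - r m" if "m \<le> n" for m n
  proof (cases "m = n")
    case False
    define s t where "s = 1 / (real m + 1)" and "t = 1 / (real n + 1)"
    have st: "0 < t" "t < s" using that False by (auto simp: s_def t_def field_simps)
    define u v where "u = z m - a" and "v = z n - a"
    \<comment> \<open>In terms of \<open>u\<close> and \<open>v\<close>, monotonicity reads \<open>\<langle>s u - t v, u - v\<rangle> \<le> 0\<close>; splitting
      \<open>s u - t v = (s - t) u + t (u - v)\<close> isolates the sign of \<open>\<langle>u, u - v\<rangle>\<close>.\<close>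
    have "inner (s *\<^sub>R (a - z m) - t *\<^sub>R (a - z n)) (z m - z n) \<ge> 0"
      using nonexpansive_monotone[OF ne zC zC, of m n] unfolding z s_def t_def .
    moreover have "s *\<^sub>R (a - z m) - t *\<^sub>R (a - z n) = - ((s - t) *\<^sub>R u + t *\<^sub>R (u - v))"
      by (simp add: u_def v_def algebra_simps)
    moreover have "z m - z n = u - v" by (simp add: u_def v_def)
    ultimately have "(s - t) * inner u (u - v) + t * (norm (u - v))\<^sup>2 \<le> 0"
      by (simp add: inner_diff_left[of "- _"] power2_norm_eq_inner)
    moreover have "t * (norm (u - v))\<^sup>2 \<ge> 0" using st by simp
    ultimately have "(s - t) * inner u (u - v) \<le> 0" by linarith
    then have "inner u (u - v) \<le> 0" using st by (simp add: mult_le_0_iff)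
    then have "inner (z n - z m) (z m - a) \<ge> 0"
      by (simp add: u_def v_def inner_diff_left inner_diff_right inner_commute)
    then show ?thesis unfolding r_def by (rule obtuse_angle_norm_le)
  qed simp
  have fixed_bound: "norm (z n - a) \<le> norm (q - a)" if "q \<in> fixed_points C T" for n q
  proof -
    have q: "q \<in> C" "T q = q" using that by (auto simp: fixed_points_def)
    have "inner ((1 / (real n + 1)) *\<^sub>R (a - z n)) (z n - q) \<ge> 0"
      using nonexpansive_monotone[OF ne zC q(1), of n] unfolding z q(2) by simp
    then have "inner (a - z n) (z n - q) \<ge> 0"
      by (simp add: zero_le_divide_iff)
    then have "inner (q - z n) (z n - a) \<ge> 0"
      by (simp add: inner_diff_left inner_diff_right inner_commute)
    then have "(norm (q - z n))\<^sup>2 \<le> (norm (q - a))\<^sup>2 - (norm (z n - a))\<^sup>2"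
      by (rule obtuse_angle_norm_le)
    then have "(norm (z n - a))\<^sup>2 \<le> (norm (q - a))\<^sup>2"
      using zero_le_power2[of "norm (q - z n)"] by linarith
    then show ?thesis by (rule power2_le_imp_le) simp
  qed
  obtain q where q: "q \<in> fixed_points C T" using assms(5) by blast
  have "incseq r" unfolding incseq_def using gap by (smt (verit) zero_le_power2)
  moreover have "r n \<le> (norm (q - a))\<^sup>2" for n
    unfolding r_def using fixed_bound[OF q] by (simp add: power_mono)
  ultimately obtain R where R: "r \<longlonglongrightarrow> R" "\<And>n. r n \<le> R"
    using incseq_convergent by (metis (no_types))
  have "convergent z"
  proof (rule convergent_if_dist_le_null[where e = "\<lambda>n. R - r n"])
    show "(\<lambda>n. R - r n) \<longlonglongrightarrow> 0" using tendsto_diff[OF tendsto_const[of R] R(1)] by simp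
    show "(norm (z m - z n))\<^sup>2 \<le> (R - r m) + (R - r n)" if "m \<le> n" for m n
      using gap[OF that] R(2)[of n] by (simp add: norm_minus_commute)
  qed
  then obtain p where p: "z \<longlonglongrightarrow> p" by (auto simp: convergent_def)
  have pC: "p \<in> C" using closed_sequentially[OF assms(1) _ p] zC by blast
  have "(\<lambda>n. z n - T (z n)) \<longlonglongrightarrow> p - T p"
  proof (intro tendsto_diff p)
    have null: "(\<lambda>n. norm (z n - p)) \<longlonglongrightarrow> 0" using p by (simp add: LIM_zero tendsto_norm_zero)
    have "(\<lambda>n. T (z n) - T p) \<longlonglongrightarrow> 0"
      by (rule Lim_null_comparison[OF _ null]) (use ne zC pC in \<open>auto simp: nonexpansive_on_def\<close>)
    then show "(\<lambda>n. T (z n)) \<longlonglongrightarrow> T p" by (rule LIM_zero_cancel)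
  qed
  moreover have "(\<lambda>n. z n - T (z n)) \<longlonglongrightarrow> 0 *\<^sub>R (a - p)"
    unfolding z
  proof (intro tendsto_scaleR tendsto_diff tendsto_const p)
    show "(\<lambda>n. 1 / (real n + 1)) \<longlonglongrightarrow> 0"
      using LIMSEQ_inverse_real_of_nat by (simp add: inverse_eq_divide add.commute)
  qed
  ultimately have "p - T p = 0" using LIMSEQ_unique by fastforce
  then have pF: "p \<in> fixed_points C T" using pC by (simp add: fixed_points_def)
  have "norm (a - p) \<le> norm (a - q)" if "q \<in> fixed_points C T" for q
  proof -
    have "(\<lambda>n. norm (a - z n)) \<longlonglongrightarrow> norm (a - p)" by (intro tendsto_intros p)
    then show ?thesis
      by (rule LIMSEQ_le_const2) (use fixed_bound[OF that] in \<open>auto simp: norm_minus_commute\<close>)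
  qed
  with that zC z p pF show thesis by blast
qed

text \<open>
  This replaces weak compactness and demiclosedness. Monotonicity of \<open>I - T\<close> between an
  approximant \<open>z\<^sub>k\<close> and \<open>w\<^sub>n\<close> turns the vanishing of \<open>w\<^sub>n - T w\<^sub>n\<close> into
  \<open>\<parallel>a - z\<^sub>k\<parallel> \<le> d\<close>, and \<open>z\<^sub>k\<close> tends to a nearest fixed point.
\<close>

lemma nearest_fixed_point_dist_le:
  fixes C :: "'a::{real_inner,complete_space} set" and w :: "nat \<Rightarrow> 'a"
  assumes "closed C" and "convex C" and "T \<in> C \<rightarrow> C" and ne: "nonexpansive_on C T"
    and "fixed_points C T \<noteq> {}" and "a \<in> C"
    and wC: "\<And>n. w n \<in> C" and w: "(\<lambda>n. w n - T (w n)) \<longlonglongrightarrow> 0"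
    and d: "\<And>n. norm (w n - a) \<le> d"
  shows "\<exists>p\<in>fixed_points C T. (\<forall>q\<in>fixed_points C T. norm (a - p) \<le> norm (a - q)) \<and> norm (a - p) \<le> d"
proof -
  obtain z p where zC: "\<And>n::nat. z n \<in> C"
    and z: "\<And>n. z n - T (z n) = (1 / (real n + 1)) *\<^sub>R (a - z n)"
    and p: "z \<longlonglongrightarrow> p" "p \<in> fixed_points C T"
    and near: "\<And>q. q \<in> fixed_points C T \<Longrightarrow> norm (a - p) \<le> norm (a - q)"
    using browder_approximants[OF assms(1-6)] by blast
  have "norm (a - z k) \<le> d" for k
  proof -
    define \<rho> where "\<rho> = norm (a - z k)"
    have "d \<ge> 0" "\<rho> \<ge> 0" using order_trans[OF norm_ge_zero d] by (auto simp: \<rho>_def)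
    define c where "c = 1 / (real k + 1)"
    have "c > 0" by (simp add: c_def)
    have bound: "- (norm (w n - T (w n)) * (\<rho> + d)) \<le> c * (\<rho> * d - \<rho>\<^sup>2)" for n
    proof -
      have "norm (z k - w n) \<le> \<rho> + d"
        using norm_triangle_ineq4[of "z k - a" "w n - a"] d[of n]
        by (simp add: \<rho>_def norm_minus_commute)
      then have "norm (w n - T (w n)) * norm (z k - w n) \<le> norm (w n - T (w n)) * (\<rho> + d)"
        by (simp add: mult_left_mono)
      moreover have "\<bar>inner (w n - T (w n)) (z k - w n)\<bar> \<le> norm (w n - T (w n)) * norm (z k - w n)"
        by (rule Cauchy_Schwarz_ineq2)
      moreover have "inner (w n - T (w n)) (z k - w n) \<le> c * inner (a - z k) (z k - w n)"
        using nonexpansive_monotone[OF ne zC wC, of k n] unfolding z c_def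
        by (simp only: inner_diff_left[of "_ *\<^sub>R _"] inner_scaleR_left)
      moreover have "inner (a - z k) (z k - w n) \<le> \<rho> * d - \<rho>\<^sup>2"
      proof -
        have "inner (a - z k) (z k - w n) = inner (a - z k) (a - w n) - \<rho>\<^sup>2"
          unfolding \<rho>_def power2_norm_eq_inner by (simp add: inner_diff_right)
        moreover have "inner (a - z k) (a - w n) \<le> \<rho> * norm (a - w n)"
          unfolding \<rho>_def by (rule norm_cauchy_schwarz)
        moreover have "\<rho> * norm (a - w n) \<le> \<rho> * d"
          using d[of n] \<open>\<rho> \<ge> 0\<close> by (simp add: mult_left_mono norm_minus_commute)
        ultimately show ?thesis by linarith
      qed
      then have "c * inner (a - z k) (z k - w n) \<le> c * (\<rho> * d - \<rho>\<^sup>2)"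
        using \<open>c > 0\<close> by simp
      ultimately show ?thesis by linarith
    qed
    have "(\<lambda>n. - (norm (w n - T (w n)) * (\<rho> + d))) \<longlonglongrightarrow> - (norm (0::'a) * (\<rho> + d))"
      by (intro tendsto_intros w)
    then have "- (norm (0::'a) * (\<rho> + d)) \<le> c * (\<rho> * d - \<rho>\<^sup>2)"
      by (rule LIMSEQ_le_const2) (use bound in blast)
    then have "0 \<le> \<rho> * (d - \<rho>)"
      using \<open>c > 0\<close> by (simp add: zero_le_mult_iff power2_eq_square right_diff_distrib)
    then show ?thesis
      using \<open>d \<ge> 0\<close> \<open>\<rho> \<ge> 0\<close> unfolding \<rho>_def[symmetric] by (auto simp: zero_le_mult_iff)
  qed
  moreover have "(\<lambda>k. norm (a - z k)) \<longlonglongrightarrow> norm (a - p)" by (intro tendsto_intros p)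
  ultimately have "norm (a - p) \<le> d" by (intro LIMSEQ_le_const2) auto
  with p(2) near show ?thesis by blast
qed

section \<open>Strong convergence of the hybrid projection scheme\<close>

theorem theorem4p3:
  fixes C :: "'a::{real_inner,complete_space} set"
    and T :: "'a \<Rightarrow> 'a"
    and \<alpha> :: real
    and a :: "nat \<Rightarrow> real"
    and x y :: "nat \<Rightarrow> 'a"
    and Cn Cstar Q :: "nat \<Rightarrow> 'a set"
  assumes "C \<noteq> {}" and "closed C" and "convex C"
    and "T \<in> C \<rightarrow> C" and "nonexpansive_on C T"
    and "fixed_points C T \<noteq> {}"
    and "0 < \<alpha>" and "\<And>n. \<alpha> \<le> a n" and "\<And>n. a n \<le> 1"
    and "x 0 \<in> C"
    and "\<And>n. y n = (1 - a n) *\<^sub>R x n + a n *\<^sub>R T (x n)"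
    and "\<And>n. Cn n = {z \<in> C. norm (y n - z) \<le> norm (x n - z)}"
    and "\<And>n. Q n = {z \<in> C. inner (z - x n) (x n - x 0) \<ge> 0}"
    and "\<And>n. closed (Cstar n)" and "\<And>n. convex (Cstar n)"
    and "\<And>n. fixed_points C T \<subseteq> Cstar n" and "\<And>n. Cstar n \<subseteq> Cn n"
    and "\<And>n. x (Suc n) = metric_proj (Cstar n \<inter> Q n) (x 0)"
  shows "x \<longlonglongrightarrow> metric_proj (fixed_points C T) (x 0)"
proof -
  let ?F = "fixed_points C T"
  let ?D = "\<lambda>n. Cstar n \<inter> Q n"
  have Q_halfspace: "Q n = C \<inter> {z. inner (x n - x 0) z \<ge> inner (x n - x 0) (x n)}" for n
    by (auto simp: assms(13) inner_diff_left inner_commute)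
  have D_closed: "closed (?D n)" and D_convex: "convex (?D n)" for n
    unfolding Q_halfspace using assms(2,3,14,15)
    by (auto intro!: closed_Int convex_Int closed_halfspace_ge convex_halfspace_ge)
  have F_D: "?F \<subseteq> ?D n" for n
  proof (induction n)
    case 0
    then show ?case using assms(16)[of 0] by (auto simp: assms(13) fixed_points_def)
  next
    case (Suc n)
    then have "inner (z - x (Suc n)) (x (Suc n) - x 0) \<ge> 0" if "z \<in> ?F" for z
      using metric_proj_variational[OF D_closed D_convex, of z n "x 0"] that
      unfolding assms(18)[of n] by blast
    then show ?case using assms(16)[of "Suc n"] by (auto simp: assms(13) fixed_points_def)
  qed
  have step_D: "x (Suc n) \<in> ?D n" for n
    unfolding assms(18)[of n]
    by (intro metric_proj_nearest(1) nearest_point_exists D_closed D_convex)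
      (use F_D assms(6) in blast)
  have xC: "x n \<in> C" for n
    using step_D assms(10) by (cases n) (auto simp: assms(13))
  define r where "r n = norm (x n - x 0)" for n
  have obtuse: "(norm (z - x n))\<^sup>2 \<le> (norm (z - x 0))\<^sup>2 - (r n)\<^sup>2" if "z \<in> ?D n" for z n
    unfolding r_def using that by (intro obtuse_angle_norm_le) (auto simp: assms(13))
  have r_le: "r n \<le> norm (z - x 0)" if "z \<in> ?D n" for z n
  proof (rule power2_le_imp_le)
    show "(r n)\<^sup>2 \<le> (norm (z - x 0))\<^sup>2"
      using obtuse[OF that] zero_le_power2[of "norm (z - x n)"] by linarith
  qed simp
  obtain q where q: "q \<in> ?F" using assms(6) by blast
  have "incseq r" using r_le[OF step_D] by (auto intro!: incseq_SucI simp: r_def)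
  moreover have "r n \<le> norm (q - x 0)" for n using r_le F_D q by blast
  ultimately obtain d where d: "r \<longlonglongrightarrow> d" "\<And>n. r n \<le> d"
    using incseq_convergent by (metis (no_types))
  have "(\<lambda>n. norm (x (Suc n) - x n)) \<longlonglongrightarrow> 0"
  proof -
    have "(\<lambda>n. (r (Suc n))\<^sup>2 - (r n)\<^sup>2) \<longlonglongrightarrow> d\<^sup>2 - d\<^sup>2"
      by (intro tendsto_intros d(1) LIMSEQ_Suc)
    then have "(\<lambda>n. (r (Suc n))\<^sup>2 - (r n)\<^sup>2) \<longlonglongrightarrow> 0" by simp
    then have "(\<lambda>n. x (Suc n) - x n) \<longlonglongrightarrow> 0"
      by (rule tendsto_0_if_norm_square_le) (use obtuse[OF step_D] in \<open>simp add: r_def\<close>)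
    then show ?thesis by (rule tendsto_norm_zero)
  qed
  then have step_null: "(\<lambda>n. 2 / \<alpha> * norm (x (Suc n) - x n)) \<longlonglongrightarrow> 0"
    by (rule tendsto_mult_right_zero)
  have residual: "norm (x n - T (x n)) \<le> 2 / \<alpha> * norm (x (Suc n) - x n)" for n
  proof -
    have "norm (y n - x (Suc n)) \<le> norm (x n - x (Suc n))"
      using step_D[of n] assms(17)[of n] by (auto simp: assms(12))
    then have "norm (x n - y n) \<le> 2 * norm (x (Suc n) - x n)"
      using norm_triangle_ineq4[of "x n - x (Suc n)" "y n - x (Suc n)"]
      by (simp add: norm_minus_commute)
    moreover have "x n - y n = a n *\<^sub>R (x n - T (x n))"
      by (simp add: assms(11) algebra_simps)
    moreover have "\<alpha> * norm (x n - T (x n)) \<le> \<bar>a n\<bar> * norm (x n - T (x n))"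
      using assms(8)[of n] by (intro mult_right_mono) auto
    ultimately have "\<alpha> * norm (x n - T (x n)) \<le> 2 * norm (x (Suc n) - x n)" by simp
    then show ?thesis using assms(7) by (simp add: field_simps)
  qed
  have "(\<lambda>n. x n - T (x n)) \<longlonglongrightarrow> 0"
    by (rule Lim_null_comparison[OF _ step_null]) (intro always_eventually allI residual)
  from nearest_fixed_point_dist_le[OF assms(2-6) assms(10), of x, OF xC this d(2)[unfolded r_def]]
  obtain p where p: "p \<in> ?F" "\<forall>q\<in>?F. norm (x 0 - p) \<le> norm (x 0 - q)" "norm (x 0 - p) \<le> d"
    by blast
  \<comment> \<open>The bound on \<open>p\<close> carries over to the point selected by \<open>metric_proj\<close>, since all nearest
    fixed points have the same distance to \<open>x 0\<close>.\<close>
  define P where "P = metric_proj ?F (x 0)"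
  have ex: "\<exists>p\<in>?F. \<forall>q\<in>?F. norm (x 0 - p) \<le> norm (x 0 - q)" using p by blast
  have PF: "P \<in> ?F" unfolding P_def by (rule metric_proj_nearest(1)[OF ex])
  have "norm (P - x 0) \<le> d"
    using metric_proj_nearest(2)[OF ex p(1)] p(3) unfolding P_def
    by (simp add: norm_minus_commute)
  then have P_sq: "(norm (P - x 0))\<^sup>2 \<le> d\<^sup>2" by (simp add: power_mono)
  have "(\<lambda>n. d\<^sup>2 - (r n)\<^sup>2) \<longlonglongrightarrow> d\<^sup>2 - d\<^sup>2" by (intro tendsto_intros d(1))
  then have "(\<lambda>n. d\<^sup>2 - (r n)\<^sup>2) \<longlonglongrightarrow> 0" by simp
  then have "(\<lambda>n. x n - P) \<longlonglongrightarrow> 0"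
  proof (rule tendsto_0_if_norm_square_le)
    fix n
    have "(norm (P - x n))\<^sup>2 \<le> (norm (P - x 0))\<^sup>2 - (r n)\<^sup>2" using obtuse F_D PF by blast
    with P_sq show "(norm (x n - P))\<^sup>2 \<le> d\<^sup>2 - (r n)\<^sup>2" by (simp add: norm_minus_commute)
  qed
  then show ?thesis unfolding P_def[symmetric] by (rule LIM_zero_cancel)
qed

end
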